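(* Let $H$ be a complex Hilbert space, let $A\in\mathcal{B}(H)$ and $B\in\mathcal{B}(\ell^2)$ be positive, and let $F=\{f_n\}_{n\in\mathbb{N}}\subset H$ be a sequence. Let $C_{AB}=C_FA$ and $D_{AB}=D_FB$ be densely defined on their natural domains, and suppose that $S_{AB}=D_{AB}C_{AB}$ is densely defined. Assume that the reduced weighted adjoints $C_{AB}^{\#}$, $D_{AB}^{\#}$ and $S_{AB}^{\#}$ exist. Then: (1) $P_BC_{AB}\subseteq D_{AB}^{\#}$. (2) $P_AD_{AB}P_B\subseteq C_{AB}^{\#}$. (3) $C_{AB}^{\#}D_{AB}^{\#}\subseteq S_{AB}^{\#}$. (4) $P_AS_{AB}\subseteq S_{AB}^{\#}$.
   Context: $\ell^2=\ell^2(\mathbb{N})$ is the complex Hilbert space of square-summable sequences; inner products are linear in the first variable; $\langle f,g\rangle_A=\langle Af,g\rangle$ on $H$ and $\langle c,d\rangle_B=\langle Bc,d\rangle$ on $\ell^2$. $\mathcal{D}$, $\mathcal{R}$ denote domain and range, $T^*$ the Hilbert-space adjoint; $P_A$ and $P_B$ are the orthogonal projections onto $\overline{\mathcal{R}(A)}$ and $\overline{\mathcal{R}(B)}$. Products of operators have natural domains, and $S\subseteq T$ means $T$ extends $S$. Operators associated with $F$: $C_Ff=\{\langle f,f_n\rangle\}_n$ with $\mathcal{D}(C_F)=\{f\in H:\sum_n|\langle f,f_n\rangle|^2<\infty\}$; $D_Fc=\sum_{n=1}^\infty c_nf_n$ with $\mathcal{D}(D_F)=\{c\in\ell^2:\sum_{n=1}^\infty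 c_nf_n\text{ converges in }H\}$; $C_{AB}=C_FA$, i.e. $C_{AB}f=\{\langle f,f_n\rangle_A\}_n$ with $\mathcal{D}(C_{AB})=\{f\in H:\{\langle f,f_n\rangle_A\}_n\in\ell^2\}$; $D_{AB}=D_FB$ with $\mathcal{D}(D_{AB})=\{c\in\ell^2:Bc\in\mathcal{D}(D_F)\}$; $S_{AB}=D_{AB}C_{AB}$ with $\mathcal{D}(S_{AB})=\{f\in\mathcal{D}(C_{AB}):C_{AB}f\in\mathcal{D}(D_{AB})\}$. Reduced weighted adjoints. For densely defined $T:\mathcal{D}(T)\subseteq H\to\ell^2$, $T^{\#}$ is the unique operator from $\ell^2$ to $H$ with $AT^{\#}=T^*B$ and $\mathcal{R}(T^{\#})\subseteq\overline{\mathcal{R}(A)}$; it exists when $\mathcal{R}(T^*B)\subseteq\mathcal{R}(A)$. For densely defined $R:\mathcal{D}(R)\subseteq\ell^2\to H$, $R^{\#}$ is the unique operator from $H$ to $\ell^2$ with $BR^{\#}=R^*A$ and $\mathcal{R}(R^{\#})\subseteq\overline{\mathcal{R}(B)}$; it exists when $\mathcal{R}(R^*A)\subseteq\mathcal{R}(B)$. For a densely defined closable $S:\mathcal{D}(S)\subseteq H\to H$, the $A$-adjoint $S^{\#}$ is the unique operator on $H$ with $AS^{\#}=S^*A$ and $\mathcal{R}(S^{\#})\subseteq\overline{\mathcal{R}(A)}$; it exists when $\mathcal{R}(S^*A)\subseteq\mathcal{R}(A)$. All these operator equalities include equality of domains. *)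

theory Defs
  imports "HOL-Analysis.Analysis"
begin

section \<open>Complex Hilbert spaces\<close>

text \<open>The inner product is linear in the first variable. Definiteness follows from
  \<open>cinner_self\<close> and the norm axioms; completeness is inherited from \<^class>\<open>banach\<close>.\<close>

class chilbert_space = banach +
  fixes scaleC :: "complex \<Rightarrow> 'a \<Rightarrow> 'a" (infixr "*\<^sub>C" 75)
    and cinner :: "'a \<Rightarrow> 'a \<Rightarrow> complex"
  assumes scaleC_add_right: "a *\<^sub>C (x + y) = a *\<^sub>C x + a *\<^sub>C y"
    and scaleC_add_left: "(a + b) *\<^sub>C x = a *\<^sub>C x + b *\<^sub>C x"
    and scaleC_scaleC: "a *\<^sub>C (b *\<^sub>C x) = (a * b) *\<^sub>C x"
    and scaleC_one: "1 *\<^sub>C x = x"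
    and scaleR_scaleC: "r *\<^sub>R x = complex_of_real r *\<^sub>C x"
    and cinner_commute: "cinner x y = cnj (cinner y x)"
    and cinner_add_left: "cinner (x + y) z = cinner x z + cinner y z"
    and cinner_scaleC_left: "cinner (a *\<^sub>C x) y = a * cinner x y"
    and cinner_self: "cinner x x = complex_of_real ((norm x)\<^sup>2)"


section \<open>The space of square-summable complex sequences\<close>

definition square_summable :: "(nat \<Rightarrow> complex) \<Rightarrow> bool" where
  "square_summable c \<longleftrightarrow> summable (\<lambda>n. (cmod (c n))\<^sup>2)"

lemma square_summable_zero: "square_summable (\<lambda>_. 0)"
  by (simp add: square_summable_def)

lemma square_summable_add:
  assumes "square_summable c" "square_summable d"
  shows "square_summable (\<lambda>n. c n + d n)"
  unfolding square_summable_def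
proof (rule summable_comparison_test')
  show "summable (\<lambda>n. 2 * (cmod (c n))\<^sup>2 + 2 * (cmod (d n))\<^sup>2)"
    using assms by (auto simp: square_summable_def intro!: summable_add summable_mult)
  fix n :: nat
  have "(cmod (c n + d n))\<^sup>2 \<le> (cmod (c n) + cmod (d n))\<^sup>2"
    by (intro power_mono norm_triangle_ineq) auto
  also have "\<dots> \<le> 2 * (cmod (c n))\<^sup>2 + 2 * (cmod (d n))\<^sup>2"
    using sum_squares_bound[of "cmod (c n)" "cmod (d n)"] by (simp add: power2_sum)
  finally show "norm ((cmod (c n + d n))\<^sup>2) \<le> 2 * (cmod (c n))\<^sup>2 + 2 * (cmod (d n))\<^sup>2"
    by simp
qed

lemma square_summable_mult:
  assumes "square_summable c"
  shows "square_summable (\<lambda>n. a * c n)"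
  using assms summable_mult[of "\<lambda>n. (cmod (c n))\<^sup>2" "(cmod a)\<^sup>2"]
  by (simp add: square_summable_def norm_mult power_mult_distrib)

lemma square_summable_minus:
  "square_summable c \<Longrightarrow> square_summable (\<lambda>n. - c n)"
  using square_summable_mult[of c "-1"] by simp

lemma square_summable_diff:
  "square_summable c \<Longrightarrow> square_summable d \<Longrightarrow> square_summable (\<lambda>n. c n - d n)"
  using square_summable_add[OF _ square_summable_minus, of c d] by simp

lemma square_summable_product:
  assumes "square_summable c" "square_summable d"
  shows "summable (\<lambda>n. c n * cnj (d n))"
proof (rule summable_comparison_test')
  show "summable (\<lambda>n. (cmod (c n))\<^sup>2 + (cmod (d n))\<^sup>2)"
    using assms by (auto simp: square_summable_def intro!: summable_add)
  fix n :: nat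
  have "2 * (cmod (c n) * cmod (d n)) \<le> (cmod (c n))\<^sup>2 + (cmod (d n))\<^sup>2"
    using sum_squares_bound[of "cmod (c n)" "cmod (d n)"] by simp
  moreover have "0 \<le> cmod (c n) * cmod (d n)" by simp
  moreover have "norm (c n * cnj (d n)) = cmod (c n) * cmod (d n)" by (simp add: norm_mult)
  ultimately show "norm (c n * cnj (d n)) \<le> (cmod (c n))\<^sup>2 + (cmod (d n))\<^sup>2"
    by linarith
qed

lemma L2_set_le_sqrt_suminf:
  assumes "square_summable c"
  shows "L2_set (\<lambda>n. cmod (c n)) {..<k} \<le> sqrt (\<Sum>n. (cmod (c n))\<^sup>2)"
  using assms unfolding L2_set_def square_summable_def
  by (intro real_sqrt_le_mono sum_le_suminf) auto

lemma sqrt_suminf_le: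
  assumes bound: "\<And>k. L2_set (\<lambda>n. cmod (c n)) {..<k} \<le> e"
  shows "square_summable c" "sqrt (\<Sum>n. (cmod (c n))\<^sup>2) \<le> e"
proof -
  have e0: "0 \<le> e" using bound[of 0] by simp
  have le: "(\<Sum>n<k. (cmod (c n))\<^sup>2) \<le> e\<^sup>2" for k
    using bound[of k] unfolding L2_set_def by (simp add: sqrt_le_D)
  show s: "square_summable c"
    unfolding square_summable_def by (rule summableI_nonneg_bounded[OF _ le]) auto
  have "(\<Sum>n. (cmod (c n))\<^sup>2) \<le> e\<^sup>2"
    using s le unfolding square_summable_def by (intro suminf_le_const) auto
  then show "sqrt (\<Sum>n. (cmod (c n))\<^sup>2) \<le> e"
    using e0 by (simp add: real_le_lsqrt)
qed

typedef ell2 = "{c. square_summable c}" morphisms coord Abs_ell2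
  using square_summable_zero by blast

setup_lifting type_definition_ell2

lemma square_summable_coord: "square_summable (coord c)"
  using coord by simp

lemma ell2_eqI: "(\<And>n. coord c n = coord d n) \<Longrightarrow> c = d"
  by (simp add: coord_inject[symmetric] fun_eq_iff)

instantiation ell2 :: real_normed_vector
begin

lift_definition zero_ell2 :: ell2 is "\<lambda>_. 0"
  by (rule square_summable_zero)
lift_definition plus_ell2 :: "ell2 \<Rightarrow> ell2 \<Rightarrow> ell2" is "\<lambda>c d n. c n + d n"
  by (rule square_summable_add)
lift_definition minus_ell2 :: "ell2 \<Rightarrow> ell2 \<Rightarrow> ell2" is "\<lambda>c d n. c n - d n"
  by (rule square_summable_diff)
lift_definition uminus_ell2 :: "ell2 \<Rightarrow> ell2" is "\<lambda>c n. - c n"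
  by (rule square_summable_minus)
lift_definition scaleR_ell2 :: "real \<Rightarrow> ell2 \<Rightarrow> ell2" is "\<lambda>r c n. complex_of_real r * c n"
  by (rule square_summable_mult)

definition norm_ell2 :: "ell2 \<Rightarrow> real" where
  "norm_ell2 c = sqrt (\<Sum>n. (cmod (coord c n))\<^sup>2)"
definition dist_ell2 :: "ell2 \<Rightarrow> ell2 \<Rightarrow> real" where
  "dist_ell2 c d = norm (c - d)"
definition sgn_ell2 :: "ell2 \<Rightarrow> ell2" where
  "sgn_ell2 c = inverse (norm c) *\<^sub>R c"
definition uniformity_ell2 :: "(ell2 \<times> ell2) filter" where
  "uniformity_ell2 = (INF e\<in>{0<..}. principal {(x, y). dist x y < e})"
definition open_ell2 :: "ell2 set \<Rightarrow> bool" where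
  "open_ell2 U \<longleftrightarrow> (\<forall>x\<in>U. \<forall>\<^sub>F (x', y) in uniformity. x' = x \<longrightarrow> y \<in> U)"

instance
proof
  fix x y z :: ell2 and a b :: real and U :: "ell2 set"
  show "x + y + z = x + (y + z)" by (rule ell2_eqI) (simp add: plus_ell2.rep_eq)
  show "x + y = y + x" by (rule ell2_eqI) (simp add: plus_ell2.rep_eq)
  show "0 + x = x" by (rule ell2_eqI) (simp add: plus_ell2.rep_eq zero_ell2.rep_eq)
  show "- x + x = 0"
    by (rule ell2_eqI) (simp add: plus_ell2.rep_eq zero_ell2.rep_eq uminus_ell2.rep_eq)
  show "x - y = x + - y"
    by (rule ell2_eqI) (simp add: plus_ell2.rep_eq minus_ell2.rep_eq uminus_ell2.rep_eq)
  show "a *\<^sub>R (x + y) = a *\<^sub>R x + a *\<^sub>R y"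
    by (rule ell2_eqI) (simp add: plus_ell2.rep_eq scaleR_ell2.rep_eq algebra_simps)
  show "(a + b) *\<^sub>R x = a *\<^sub>R x + b *\<^sub>R x"
    by (rule ell2_eqI) (simp add: plus_ell2.rep_eq scaleR_ell2.rep_eq algebra_simps)
  show "a *\<^sub>R b *\<^sub>R x = (a * b) *\<^sub>R x"
    by (rule ell2_eqI) (simp add: scaleR_ell2.rep_eq)
  show "1 *\<^sub>R x = x"
    by (rule ell2_eqI) (simp add: scaleR_ell2.rep_eq)
  show "dist x y = norm (x - y)" by (rule dist_ell2_def)
  show "sgn x = inverse (norm x) *\<^sub>R x" by (rule sgn_ell2_def)
  show "uniformity = (INF e\<in>{0<..}. principal {(x :: ell2, y). dist x y < e})"
    by (rule uniformity_ell2_def)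
  show "open U \<longleftrightarrow> (\<forall>x\<in>U. \<forall>\<^sub>F (x', y) in uniformity. x' = x \<longrightarrow> y \<in> U)"
    by (rule open_ell2_def)
  show "norm x = 0 \<longleftrightarrow> x = 0"
  proof
    assume "norm x = 0"
    then have "(\<Sum>n. (cmod (coord x n))\<^sup>2) = 0" by (simp add: norm_ell2_def)
    then have "\<forall>n. (cmod (coord x n))\<^sup>2 = 0"
      by (rule iffD1[OF suminf_eq_zero_iff, rotated 2])
        (rule square_summable_coord[unfolded square_summable_def], rule zero_le_power2)
    then show "x = 0" by (intro ell2_eqI) (simp add: zero_ell2.rep_eq)
  qed (simp add: norm_ell2_def zero_ell2.rep_eq)
  show "norm (x + y) \<le> norm x + norm y"
    unfolding norm_ell2_def
  proof (rule sqrt_suminf_le(2))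
    fix k
    have "L2_set (\<lambda>n. cmod (coord (x + y) n)) {..<k}
        \<le> L2_set (\<lambda>n. cmod (coord x n) + cmod (coord y n)) {..<k}"
      by (rule L2_set_mono) (auto simp: plus_ell2.rep_eq norm_triangle_ineq)
    also have "\<dots> \<le> L2_set (\<lambda>n. cmod (coord x n)) {..<k} + L2_set (\<lambda>n. cmod (coord y n)) {..<k}"
      by (rule L2_set_triangle_ineq)
    also have "\<dots> \<le> sqrt (\<Sum>n. (cmod (coord x n))\<^sup>2) + sqrt (\<Sum>n. (cmod (coord y n))\<^sup>2)"
      by (intro add_mono L2_set_le_sqrt_suminf square_summable_coord)
    finally show "L2_set (\<lambda>n. cmod (coord (x + y) n)) {..<k}
        \<le> sqrt (\<Sum>n. (cmod (coord x n))\<^sup>2) + sqrt (\<Sum>n. (cmod (coord y n))\<^sup>2)" .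
  qed
  show "norm (a *\<^sub>R x) = \<bar>a\<bar> * norm x"
    using suminf_mult[of "\<lambda>n. (cmod (coord x n))\<^sup>2" "a\<^sup>2"] square_summable_coord[of x]
    by (simp add: norm_ell2_def scaleR_ell2.rep_eq norm_mult power_mult_distrib
        square_summable_def real_sqrt_mult)
qed

end

lemma cmod_coord_le_norm: "cmod (coord c n) \<le> norm c"
proof -
  have "cmod (coord c n) \<le> L2_set (\<lambda>n. cmod (coord c n)) {..<Suc n}"
    by (rule member_le_L2_set) auto
  also have "\<dots> \<le> norm c"
    unfolding norm_ell2_def by (rule L2_set_le_sqrt_suminf[OF square_summable_coord])
  finally show ?thesis .
qed

instance ell2 :: banach
proof
  fix X :: "nat \<Rightarrow> ell2"
  assume X: "Cauchy X"
  have "Cauchy (\<lambda>m. coord (X m) n)" for n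
  proof (rule metric_CauchyI)
    fix e :: real assume "0 < e"
    then obtain M where M: "\<forall>m\<ge>M. \<forall>k\<ge>M. dist (X m) (X k) < e"
      using metric_CauchyD[OF X] by blast
    have "dist (coord (X m) n) (coord (X k) n) \<le> dist (X m) (X k)" for m k
      using cmod_coord_le_norm[of "X m - X k" n] by (simp add: dist_norm minus_ell2.rep_eq)
    then show "\<exists>M. \<forall>m\<ge>M. \<forall>k\<ge>M. dist (coord (X m) n) (coord (X k) n) < e"
      using M by (meson le_less_trans)
  qed
  then have "\<forall>n. \<exists>l. (\<lambda>m. coord (X m) n) \<longlonglongrightarrow> l"
    using Cauchy_convergent convergent_def by blast
  then obtain c where c: "\<And>n. (\<lambda>m. coord (X m) n) \<longlonglongrightarrow> c n"
    by metis
  have close: "L2_set (\<lambda>n. cmod (coord (X m) n - c n)) {..<j} \<le> e"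
    if "\<forall>k\<ge>M. dist (X m) (X k) < e" for m M j e
  proof (rule LIMSEQ_le_const2)
    show "(\<lambda>k. L2_set (\<lambda>n. cmod (coord (X m) n - coord (X k) n)) {..<j})
        \<longlonglongrightarrow> L2_set (\<lambda>n. cmod (coord (X m) n - c n)) {..<j}"
      unfolding L2_set_def by (intro tendsto_intros c)
    have "L2_set (\<lambda>n. cmod (coord (X m) n - coord (X k) n)) {..<j} \<le> dist (X m) (X k)" for k
      using L2_set_le_sqrt_suminf[OF square_summable_coord, of "X m - X k" j]
      by (simp add: dist_norm norm_ell2_def minus_ell2.rep_eq)
    then show "\<exists>N. \<forall>k\<ge>N. L2_set (\<lambda>n. cmod (coord (X m) n - coord (X k) n)) {..<j} \<le> e"
      using that by (meson le_less_trans less_imp_le)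
  qed
  obtain M where "\<forall>m\<ge>M. \<forall>k\<ge>M. dist (X m) (X k) < 1"
    using metric_CauchyD[OF X zero_less_one] by blast
  then have "\<forall>k\<ge>M. dist (X M) (X k) < 1" by blast
  from sqrt_suminf_le(1)[OF close[OF this]]
  have "square_summable (\<lambda>n. coord (X M) n - c n)" .
  then have "square_summable (\<lambda>n. coord (X M) n - (coord (X M) n - c n))"
    by (rule square_summable_diff[OF square_summable_coord])
  then have ss: "square_summable c" by simp
  have coord_c: "coord (Abs_ell2 c) = c" using ss by (simp add: Abs_ell2_inverse)
  have "X \<longlonglongrightarrow> Abs_ell2 c"
  proof (rule metric_LIMSEQ_I)
    fix e :: real assume e: "0 < e"
    then obtain M where M: "\<forall>m\<ge>M. \<forall>k\<ge>M. dist (X m) (X k) < e / 2"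
      using metric_CauchyD[OF X half_gt_zero] by blast
    have "dist (X m) (Abs_ell2 c) \<le> e / 2" if "m \<ge> M" for m
    proof -
      have "sqrt (\<Sum>n. (cmod (coord (X m) n - c n))\<^sup>2) \<le> e / 2"
        by (rule sqrt_suminf_le(2), rule close[of M]) (use M that in blast)
      then show ?thesis
        by (simp add: dist_norm norm_ell2_def minus_ell2.rep_eq coord_c)
    qed
    then show "\<exists>M. \<forall>m\<ge>M. dist (X m) (Abs_ell2 c) < e"
      using half_gt_zero[OF e] field_sum_of_halves[of e] by (smt (verit))
  qed
  then show "convergent X" by (auto simp: convergent_def)
qed

instantiation ell2 :: chilbert_space
begin

lift_definition scaleC_ell2 :: "complex \<Rightarrow> ell2 \<Rightarrow> ell2" is "\<lambda>a c n. a * c n"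
  by (rule square_summable_mult)

definition cinner_ell2 :: "ell2 \<Rightarrow> ell2 \<Rightarrow> complex" where
  "cinner_ell2 c d = (\<Sum>n. coord c n * cnj (coord d n))"

instance
proof
  fix x y z :: ell2 and a b :: complex and r :: real
  note summable_product = square_summable_product[OF square_summable_coord square_summable_coord]
  show "a *\<^sub>C (x + y) = a *\<^sub>C x + a *\<^sub>C y"
    by (rule ell2_eqI) (simp add: plus_ell2.rep_eq scaleC_ell2.rep_eq algebra_simps)
  show "(a + b) *\<^sub>C x = a *\<^sub>C x + b *\<^sub>C x"
    by (rule ell2_eqI) (simp add: plus_ell2.rep_eq scaleC_ell2.rep_eq algebra_simps)
  show "a *\<^sub>C (b *\<^sub>C x) = (a * b) *\<^sub>C x"
    by (rule ell2_eqI) (simp add: scaleC_ell2.rep_eq)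
  show "1 *\<^sub>C x = x"
    by (rule ell2_eqI) (simp add: scaleC_ell2.rep_eq)
  show "r *\<^sub>R x = complex_of_real r *\<^sub>C x"
    by (rule ell2_eqI) (simp add: scaleC_ell2.rep_eq scaleR_ell2.rep_eq)
  show "cinner x y = cnj (cinner y x)"
  proof -
    have "(\<lambda>n. cnj (coord y n * cnj (coord x n))) sums cnj (cinner y x)"
      unfolding cinner_ell2_def sums_cnj by (rule summable_sums[OF summable_product])
    then show ?thesis
      unfolding cinner_ell2_def by (simp add: sums_iff mult.commute)
  qed
  show "cinner (x + y) z = cinner x z + cinner y z"
    unfolding cinner_ell2_def
    by (simp add: plus_ell2.rep_eq distrib_right suminf_add[OF summable_product summable_product])
  show "cinner (a *\<^sub>C x) y = a * cinner x y"
    unfolding cinner_ell2_def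
    by (simp add: scaleC_ell2.rep_eq mult.assoc suminf_mult[OF summable_product])
  show "cinner x x = complex_of_real ((norm x)\<^sup>2)"
  proof -
    have s: "summable (\<lambda>n. (cmod (coord x n))\<^sup>2)"
      using square_summable_coord[of x] by (simp add: square_summable_def)
    have "(norm x)\<^sup>2 = (\<Sum>n. (cmod (coord x n))\<^sup>2)"
      by (simp add: norm_ell2_def suminf_nonneg[OF s])
    then show ?thesis
      unfolding cinner_ell2_def
      by (simp add: suminf_of_real[OF s] complex_norm_square flip: of_real_power)
  qed
qed

end


section \<open>Operators\<close>

text \<open>An operator with domain is a partial map: \<^term>\<open>dom T\<close> and \<^term>\<open>ran T\<close> are its domain and
  range, \<open>\<circ>\<^sub>m\<close> is composition on the natural domain, \<open>\<subseteq>\<^sub>m\<close> is extension, and equality includes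
  equality of domains. Everywhere defined operators are functions, embedded by \<open>total_op\<close>.\<close>

abbreviation total_op :: "('a \<Rightarrow> 'b) \<Rightarrow> ('a \<rightharpoonup> 'b)" where
  "total_op f \<equiv> (\<lambda>x. Some (f x))"

definition linear_operator :: "('a::chilbert_space \<rightharpoonup> 'b::chilbert_space) \<Rightarrow> bool" where
  "linear_operator T \<longleftrightarrow>
     T 0 = Some 0 \<and>
     (\<forall>x y u v. T x = Some u \<longrightarrow> T y = Some v \<longrightarrow> T (x + y) = Some (u + v)) \<and>
     (\<forall>a x u. T x = Some u \<longrightarrow> T (a *\<^sub>C x) = Some (a *\<^sub>C u))"

definition densely_defined :: "('a::chilbert_space \<rightharpoonup> 'b) \<Rightarrow> bool" where
  "densely_defined T \<longleftrightarrow> closure (dom T) = UNIV"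

definition closed_operator :: "('a::chilbert_space \<rightharpoonup> 'b::chilbert_space) \<Rightarrow> bool" where
  "closed_operator T \<longleftrightarrow> linear_operator T \<and> closed {(x, u). T x = Some u}"

definition closable :: "('a::chilbert_space \<rightharpoonup> 'b::chilbert_space) \<Rightarrow> bool" where
  "closable T \<longleftrightarrow> (\<exists>T'. closed_operator T' \<and> T \<subseteq>\<^sub>m T')"

text \<open>The vector \<open>z\<close> is unique when \<open>T\<close> is densely defined, the only case of interest.\<close>

definition hilbert_adjoint ::
    "('a::chilbert_space \<rightharpoonup> 'b::chilbert_space) \<Rightarrow> ('b \<rightharpoonup> 'a)" where
  "hilbert_adjoint T y =
     (if \<exists>z. \<forall>x u. T x = Some u \<longrightarrow> cinner u y = cinner x z
      then Some (THE z. \<forall>x u. T x = Some u \<longrightarrow> cinner u y = cinner x z)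
      else None)"

text \<open>\<^const>\<open>bounded_linear\<close> refers to real scalars.\<close>

definition bounded_operator :: "('a::chilbert_space \<Rightarrow> 'b::chilbert_space) \<Rightarrow> bool" where
  "bounded_operator A \<longleftrightarrow> bounded_linear A \<and> (\<forall>a x. A (a *\<^sub>C x) = a *\<^sub>C A x)"

definition positive_operator :: "('a::chilbert_space \<Rightarrow> 'a) \<Rightarrow> bool" where
  "positive_operator A \<longleftrightarrow>
     bounded_operator A \<and> (\<forall>x. cinner (A x) x \<in> \<real> \<and> 0 \<le> Re (cinner (A x) x))"

definition orthogonal_projection :: "'a::chilbert_space set \<Rightarrow> 'a \<Rightarrow> 'a" where
  "orthogonal_projection M x = (THE y. y \<in> M \<and> (\<forall>z\<in>M. cinner (x - y) z = 0))"

definition range_projection :: "('a::chilbert_space \<Rightarrow> 'a) \<Rightarrow> 'a \<Rightarrow> 'a" where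
  "range_projection A = orthogonal_projection (closure (range A))"


section \<open>Reduced weighted adjoints\<close>

text \<open>The weight \<open>A\<close> acts on the space containing the domain of \<open>T\<close>, the weight \<open>B\<close> on the target
  space, so for \<open>R\<close> from the sequence space to \<open>H\<close> the weights are passed as \<open>B\<close>, \<open>A\<close>. The adjoint
  is unique because a positive \<open>A\<close> is injective on the closure of its range.\<close>

definition is_reduced_adjoint ::
    "('a::chilbert_space \<Rightarrow> 'a) \<Rightarrow> ('b::chilbert_space \<Rightarrow> 'b) \<Rightarrow> ('a \<rightharpoonup> 'b) \<Rightarrow> ('b \<rightharpoonup> 'a) \<Rightarrow> bool" where
  "is_reduced_adjoint A B T X \<longleftrightarrow>
     linear_operator X \<and>
     total_op A \<circ>\<^sub>m X = hilbert_adjoint T \<circ>\<^sub>m total_op B \<and>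
     ran X \<subseteq> closure (range A)"

definition has_reduced_adjoint ::
    "('a::chilbert_space \<Rightarrow> 'a) \<Rightarrow> ('b::chilbert_space \<Rightarrow> 'b) \<Rightarrow> ('a \<rightharpoonup> 'b) \<Rightarrow> bool" where
  "has_reduced_adjoint A B T \<longleftrightarrow> densely_defined T \<and> (\<exists>X. is_reduced_adjoint A B T X)"

definition reduced_adjoint ::
    "('a::chilbert_space \<Rightarrow> 'a) \<Rightarrow> ('b::chilbert_space \<Rightarrow> 'b) \<Rightarrow> ('a \<rightharpoonup> 'b) \<Rightarrow> ('b \<rightharpoonup> 'a)" where
  "reduced_adjoint A B T = (THE X. is_reduced_adjoint A B T X)"

text \<open>The \<open>A\<close>-adjoint of an operator in \<open>H\<close> is only considered for closable operators.\<close>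

definition has_A_adjoint :: "('a::chilbert_space \<Rightarrow> 'a) \<Rightarrow> ('a \<rightharpoonup> 'a) \<Rightarrow> bool" where
  "has_A_adjoint A S \<longleftrightarrow> closable S \<and> has_reduced_adjoint A A S"

definition A_adjoint :: "('a::chilbert_space \<Rightarrow> 'a) \<Rightarrow> ('a \<rightharpoonup> 'a) \<Rightarrow> ('a \<rightharpoonup> 'a)" where
  "A_adjoint A S = reduced_adjoint A A S"


section \<open>Operators associated with a sequence\<close>

definition analysis_op :: "(nat \<Rightarrow> 'a::chilbert_space) \<Rightarrow> ('a \<rightharpoonup> ell2)" where
  "analysis_op F f =
     (if square_summable (\<lambda>n. cinner f (F n)) then Some (Abs_ell2 (\<lambda>n. cinner f (F n))) else None)"

definition synthesis_op :: "(nat \<Rightarrow> 'a::chilbert_space) \<Rightarrow> (ell2 \<rightharpoonup> 'a)" where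
  "synthesis_op F c =
     (if summable (\<lambda>n. coord c n *\<^sub>C F n) then Some (\<Sum>n. coord c n *\<^sub>C F n) else None)"

definition C_AB :: "('a::chilbert_space \<Rightarrow> 'a) \<Rightarrow> (nat \<Rightarrow> 'a) \<Rightarrow> ('a \<rightharpoonup> ell2)" where
  "C_AB A F = analysis_op F \<circ>\<^sub>m total_op A"

definition D_AB :: "(ell2 \<Rightarrow> ell2) \<Rightarrow> (nat \<Rightarrow> 'a::chilbert_space) \<Rightarrow> (ell2 \<rightharpoonup> 'a)" where
  "D_AB B F = synthesis_op F \<circ>\<^sub>m total_op B"

definition S_AB ::
    "('a::chilbert_space \<Rightarrow> 'a) \<Rightarrow> (ell2 \<Rightarrow> ell2) \<Rightarrow> (nat \<Rightarrow> 'a) \<Rightarrow> ('a \<rightharpoonup> 'a)" where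
  "S_AB A B F = D_AB B F \<circ>\<^sub>m C_AB A F"

end

theory Submission
  imports Defs
begin

text \<open>Everything rests on the duality \<open>\<langle>D\<^sub>F c, f\<rangle> = \<langle>c, C\<^sub>F f\<rangle>\<close>. It gives
  \<open>D\<^sub>A\<^sub>B\<^sup>* A f = B C\<^sub>A\<^sub>B f\<close> and \<open>C\<^sub>A\<^sub>B\<^sup>* B c = A D\<^sub>A\<^sub>B c\<close>; since a positive operator
  does not see the orthogonal projection onto the closure of its range and is injective there,
  (1) and (2) follow. For (3), \<open>A C\<^sub>A\<^sub>B\<^sup># D\<^sub>A\<^sub>B\<^sup># f = C\<^sub>A\<^sub>B\<^sup>* D\<^sub>A\<^sub>B\<^sup>* A f = S\<^sub>A\<^sub>B\<^sup>* A f\<close>,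
  and (4) combines the other three.\<close>

section \<open>Inner products and orthogonal projections\<close>

lemma cinner_add_right: "cinner x (y + z) = cinner x y + cinner x z"
  by (metis cinner_add_left cinner_commute complex_cnj_add)

lemma cinner_scaleC_right: "cinner x (a *\<^sub>C y) = cnj a * cinner x y"
  by (metis cinner_scaleC_left cinner_commute complex_cnj_mult)

lemma cinner_zero_left [simp]: "cinner 0 y = 0"
  using cinner_add_left[of 0 0 y] by simp

lemma cinner_zero_right [simp]: "cinner x 0 = 0"
  using cinner_add_right[of x 0 0] by simp

lemma cinner_minus_left: "cinner (- x) y = - cinner x y"
  using cinner_add_left[of x "- x" y] by (simp add: eq_neg_iff_add_eq_0 add.commute)

lemma cinner_minus_right: "cinner x (- y) = - cinner x y"
  using cinner_add_right[of x y "- y"] by (simp add: eq_neg_iff_add_eq_0 add.commute)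

lemma cinner_diff_left: "cinner (x - y) z = cinner x z - cinner y z"
  using cinner_add_left[of x "- y" z] by (simp add: cinner_minus_left)

lemma cinner_diff_right: "cinner x (y - z) = cinner x y - cinner x z"
  using cinner_add_right[of x y "- z"] by (simp add: cinner_minus_right)

lemma cinner_sum_left: "cinner (\<Sum>i\<in>I. g i) y = (\<Sum>i\<in>I. cinner (g i) y)"
  by (induction I rule: infinite_finite_induct) (auto simp: cinner_add_left)

lemma power2_norm_eq_cinner: "(norm x)\<^sup>2 = Re (cinner x x)"
  by (simp add: cinner_self)

lemma cinner_self_eq_0_iff: "cinner x x = 0 \<longleftrightarrow> x = 0"
  by (simp add: cinner_self)

lemma Re_cinner_commute: "Re (cinner y x) = Re (cinner x y)"
  by (subst cinner_commute) simp

lemma power2_norm_diff: "(norm (x - y))\<^sup>2 = (norm x)\<^sup>2 - 2 * Re (cinner x y) + (norm y)\<^sup>2"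
  by (simp add: power2_norm_eq_cinner cinner_diff_left cinner_diff_right Re_cinner_commute)

lemma power2_norm_add: "(norm (x + y))\<^sup>2 = (norm x)\<^sup>2 + 2 * Re (cinner x y) + (norm y)\<^sup>2"
  by (simp add: power2_norm_eq_cinner cinner_add_left cinner_add_right Re_cinner_commute)

text \<open>The norm axioms of the class only know real scalars; homogeneity for complex ones is
  recovered from \<open>cinner_self\<close>.\<close>

lemma norm_scaleC: "norm (a *\<^sub>C x) = cmod a * norm x"
proof -
  have "complex_of_real ((norm (a *\<^sub>C x))\<^sup>2) = a * cnj a * complex_of_real ((norm x)\<^sup>2)"
    by (simp only: cinner_self[symmetric] cinner_scaleC_left cinner_scaleC_right mult_ac)
  also have "\<dots> = complex_of_real ((cmod a * norm x)\<^sup>2)"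
    by (simp add: complex_norm_square[symmetric] power_mult_distrib)
  finally have "(norm (a *\<^sub>C x))\<^sup>2 = (cmod a * norm x)\<^sup>2"
    by (simp only: of_real_eq_iff)
  then show ?thesis by (simp add: power2_eq_iff_nonneg)
qed

lemma bounded_linear_scaleC: "bounded_linear ((*\<^sub>C) a)"
proof (rule bounded_linear_intro)
  fix x y :: 'a and r :: real
  show "a *\<^sub>C (x + y) = a *\<^sub>C x + a *\<^sub>C y" by (rule scaleC_add_right)
  show "a *\<^sub>C r *\<^sub>R x = r *\<^sub>R a *\<^sub>C x" by (simp add: scaleR_scaleC scaleC_scaleC mult.commute)
  show "norm (a *\<^sub>C x) \<le> norm x * cmod a" by (simp add: norm_scaleC mult.commute)
qed

text \<open>By polarization, which makes the Cauchy-Schwarz inequality unnecessary.\<close>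

lemma tendsto_cinner_left:
  assumes g: "(g \<longlongrightarrow> l) G"
  shows "((\<lambda>n. cinner (g n) y) \<longlongrightarrow> cinner l y) G"
proof -
  have Re: "((\<lambda>n. Re (cinner (g n) z)) \<longlongrightarrow> Re (cinner l z)) G" for z
  proof -
    have "Re (cinner x z) = ((norm (x + z))\<^sup>2 - (norm (x - z))\<^sup>2) / 4" for x
      by (simp add: power2_norm_add power2_norm_diff)
    then show ?thesis by (simp only:) (intro tendsto_intros g, simp)
  qed
  have "Im (cinner x y) = Re (cinner x (\<i> *\<^sub>C y))" for x
    by (simp add: cinner_scaleC_right)
  then show ?thesis
    using Re[of y] Re[of "\<i> *\<^sub>C y"] by (simp add: tendsto_complex_iff)
qed

lemma continuous_on_cinner_left: "continuous_on S (\<lambda>x. cinner x y)"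
  by (simp add: continuous_on_def tendsto_cinner_left)

text \<open>Two continuous functions agree on a closed set. The two uses are
  \<open>M = range A\<close>, for injectivity of \<open>A\<close>, and \<open>M = dom T\<close>, for
  uniqueness of the adjoint.\<close>

lemma cinner_left_eq_on_closure:
  assumes "\<And>x. x \<in> M \<Longrightarrow> cinner x y = cinner x z" and "x \<in> closure M"
  shows "cinner x y = cinner x z"
proof -
  have "closed {x. cinner x y = cinner x z}"
    by (intro closed_Collect_eq continuous_on_cinner_left)
  then have "closure M \<subseteq> {x. cinner x y = cinner x z}"
    using assms(1) by (intro closure_minimal) auto
  then show ?thesis using assms(2) by blast
qed

section \<open>Closed subspaces and the projection theorem\<close>

lemma subspace_closure:
  fixes M :: "'a::real_normed_vector set"
  assumes "subspace M"
  shows "subspace (closure M)"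
proof (rule subspaceI)
  show "0 \<in> closure M"
    using subspace_0[OF assms] closure_subset by blast
next
  fix x y assume "x \<in> closure M" "y \<in> closure M"
  then obtain f g where "\<forall>n. f n \<in> M" "f \<longlonglongrightarrow> x" "\<forall>n. g n \<in> M" "g \<longlonglongrightarrow> y"
    unfolding closure_sequential by blast
  then show "x + y \<in> closure M"
    unfolding closure_sequential
    by (intro exI[of _ "\<lambda>n. f n + g n"]) (auto intro: tendsto_add subspace_add[OF assms])
next
  fix r :: real and x assume "x \<in> closure M"
  then obtain f where "\<forall>n. f n \<in> M" "f \<longlonglongrightarrow> x"
    unfolding closure_sequential by blast
  then show "r *\<^sub>R x \<in> closure M"
    unfolding closure_sequential
    by (intro exI[of _ "\<lambda>n. r *\<^sub>R f n"]) (auto intro: tendsto_scaleR subspace_scale[OF assms])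
qed

text \<open>The sets of approximate minimizers are closed, nonempty and nested, and the
  parallelogram law makes their diameters shrink to 0; by completeness they share a point, which
  attains the infimum.\<close>

lemma closest_point_exists:
  fixes M :: "'a::chilbert_space set"
  assumes "closed M" "subspace M"
  obtains y where "y \<in> M" "\<And>z. z \<in> M \<Longrightarrow> norm (x - y) \<le> norm (x - z)"
proof -
  define d where "d = (INF z\<in>M. norm (x - z))"
  have ne: "M \<noteq> {}" using subspace_0[OF assms(2)] by auto
  have bdd: "bdd_below ((\<lambda>z. norm (x - z)) ` M)" by (rule bdd_belowI2[of _ 0]) simp
  have lower: "d \<le> norm (x - z)" if "z \<in> M" for z
    unfolding d_def using bdd that by (rule cINF_lower)
  have d0: "0 \<le> d" unfolding d_def using ne by (intro cINF_greatest) auto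
  have near: "\<exists>z\<in>M. norm (x - z) < d + e" if "0 < e" for e
  proof (rule ccontr)
    assume "\<not> ?thesis"
    then have "d + e \<le> d"
      unfolding d_def by (intro cINF_greatest ne) (auto simp: not_less d_def)
    then show False using that by simp
  qed
  define S where "S n = {z \<in> M. (norm (x - z))\<^sup>2 \<le> d\<^sup>2 + inverse (real (Suc n))}" for n
  have "\<exists>a. \<forall>n. a \<in> S n"
  proof (rule decreasing_closed_nest)
    fix n
    have "closed {z. (norm (x - z))\<^sup>2 \<le> d\<^sup>2 + inverse (real (Suc n))}"
      by (intro closed_Collect_le continuous_intros)
    then show "closed (S n)"
      unfolding S_def Collect_conj_eq using assms(1) by auto
    have "d < sqrt (d\<^sup>2 + inverse (real (Suc n)))"
      by (rule real_less_rsqrt) simp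
    then obtain z where "z \<in> M" "norm (x - z) < sqrt (d\<^sup>2 + inverse (real (Suc n)))"
      using near[of "sqrt (d\<^sup>2 + inverse (real (Suc n))) - d"] by auto
    moreover from this have "(norm (x - z))\<^sup>2 < (sqrt (d\<^sup>2 + inverse (real (Suc n))))\<^sup>2"
      by (intro power_strict_mono) auto
    ultimately have "z \<in> S n" by (simp add: S_def)
    then show "S n \<noteq> {}" by auto
  next
    fix m n :: nat assume "m \<le> n"
    then have "inverse (real (Suc n)) \<le> inverse (real (Suc m))" by simp
    then have "d\<^sup>2 + inverse (real (Suc n)) \<le> d\<^sup>2 + inverse (real (Suc m))"
      by (rule add_left_mono)
    then show "S n \<subseteq> S m" unfolding S_def using order_trans by blast
  next
    fix e :: real assume e: "0 < e"
    \<comment> \<open>With slack \<open>inverse (real (Suc n))\<close> in the squared distances, the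
      parallelogram law below bounds the squared diameter of \<open>S n\<close> by four times that
      slack.\<close>
    have "0 < e\<^sup>2 / 4" using e by simp
    then obtain n where n: "inverse (real (Suc n)) < e\<^sup>2 / 4"
      using reals_Archimedean by blast
    have "dist y z < e" if "y \<in> S n" "z \<in> S n" for y z
    proof -
      have yz: "y \<in> M" "z \<in> M"
        "(norm (x - y))\<^sup>2 \<le> d\<^sup>2 + inverse (real (Suc n))"
        "(norm (x - z))\<^sup>2 \<le> d\<^sup>2 + inverse (real (Suc n))"
        using that by (auto simp: S_def)
      \<comment> \<open>The midpoint stays in \<open>M\<close>, so its distance to \<open>x\<close>
        is at least \<open>d\<close>; this cancels the \<open>d\<close> terms in the parallelogram
        law.\<close>
      have "(1/2) *\<^sub>R (y + z) \<in> M"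
        using yz assms(2) by (simp add: subspace_add subspace_mul)
      then have "d\<^sup>2 \<le> (norm (x - (1/2) *\<^sub>R (y + z)))\<^sup>2"
        using lower d0 by (intro power_mono)
      moreover have "(x - y) + (x - z) = 2 *\<^sub>R (x - (1/2) *\<^sub>R (y + z))"
        by (simp add: algebra_simps scaleR_2)
      then have "(norm ((x - y) + (x - z)))\<^sup>2 = 4 * (norm (x - (1/2) *\<^sub>R (y + z)))\<^sup>2"
        by (simp only: norm_scaleR) (simp add: power_mult_distrib)
      moreover have "(norm ((x - y) + (x - z)))\<^sup>2 + (norm ((x - y) - (x - z)))\<^sup>2
          = 2 * (norm (x - y))\<^sup>2 + 2 * (norm (x - z))\<^sup>2"
        unfolding power2_norm_add power2_norm_diff[of "x - y" "x - z"] by simp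
      moreover have "(norm ((x - y) - (x - z)))\<^sup>2 = (dist y z)\<^sup>2"
        by (simp add: dist_norm norm_minus_commute)
      ultimately have "(dist y z)\<^sup>2 < e\<^sup>2" using yz n by linarith
      then show ?thesis using e by (simp add: power_less_imp_less_base)
    qed
    then show "\<exists>n. \<forall>x\<in>S n. \<forall>y\<in>S n. dist x y < e" by blast
  qed blast
  then obtain y where y: "\<And>n. y \<in> S n" by blast
  have "(\<lambda>n. d\<^sup>2 + inverse (real (Suc n))) \<longlonglongrightarrow> d\<^sup>2 + 0"
    by (intro tendsto_intros LIMSEQ_inverse_real_of_nat)
  then have "(norm (x - y))\<^sup>2 \<le> d\<^sup>2"
    using y by (intro LIMSEQ_le_const[of _ "d\<^sup>2"]) (auto simp: S_def)
  then have "norm (x - y) \<le> d" using d0 by (rule power2_le_imp_le)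
  then show thesis
    using that[of y] y[of 0] lower by (force simp: S_def)
qed

text \<open>A closest point works: if \<open>x - y\<close> had a component along some
  \<open>z\<close> in \<open>M\<close>, moving \<open>y\<close> slightly in that direction would
  bring it closer to \<open>x\<close>.\<close>

lemma orthogonal_decomposition:
  fixes M :: "'a::chilbert_space set"
  assumes "closed M" "subspace M" "\<And>a z. z \<in> M \<Longrightarrow> a *\<^sub>C z \<in> M"
  obtains y where "y \<in> M" "\<And>z. z \<in> M \<Longrightarrow> cinner (x - y) z = 0"
proof -
  obtain y where y: "y \<in> M" and min: "\<And>z. z \<in> M \<Longrightarrow> norm (x - y) \<le> norm (x - z)"
    using closest_point_exists[OF assms(1,2)] by blast
  have "cinner (x - y) z = 0" if z: "z \<in> M" for z
  proof (rule ccontr)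
    define w where "w = cinner (x - y) z"
    \<comment> \<open>The optimal step would divide by the squared norm of \<open>z\<close>. Adding
      1 keeps the denominator positive and makes \<open>s\<close> times that squared norm less than
      1, whereas minimality would force it to be at least 2.\<close>
    define s where "s = 1 / ((norm z)\<^sup>2 + 1)"
    define t where "t = complex_of_real s * w"
    assume "cinner (x - y) z \<noteq> 0"
    then have w: "0 < (cmod w)\<^sup>2" by (simp add: w_def)
    have N: "0 < (norm z)\<^sup>2 + 1" by (simp add: add_nonneg_pos)
    have s: "0 < s" unfolding s_def using N by simp
    have "y + t *\<^sub>C z \<in> M" using y z assms(2,3) by (simp add: subspace_add)
    then have "(norm (x - y))\<^sup>2 \<le> (norm ((x - y) - t *\<^sub>C z))\<^sup>2"
      using min by (intro power_mono) (auto simp: diff_diff_add)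
    also have "\<dots> = (norm (x - y))\<^sup>2 - 2 * Re (cnj t * w) + (cmod t * norm z)\<^sup>2"
      by (simp only: power2_norm_diff cinner_scaleC_right norm_scaleC w_def)
    also have "cnj t * w = complex_of_real (s * (cmod w)\<^sup>2)"
      unfolding t_def of_real_mult complex_norm_square by (simp add: mult_ac)
    also have "(cmod t * norm z)\<^sup>2 = (s * (cmod w)\<^sup>2) * (s * (norm z)\<^sup>2)"
      unfolding t_def norm_mult by (simp add: power2_eq_square)
    finally have "(s * (cmod w)\<^sup>2) * 2 \<le> (s * (cmod w)\<^sup>2) * (s * (norm z)\<^sup>2)" by simp
    then have "2 \<le> s * (norm z)\<^sup>2" using s w by simp
    moreover have "s * (norm z)\<^sup>2 < 1" unfolding s_def using N by simp
    ultimately show False by simp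
  qed
  with y show thesis by (rule that)
qed

lemma orthogonal_projection_properties:
  fixes M :: "'a::chilbert_space set"
  assumes "closed M" "subspace M" "\<And>a z. z \<in> M \<Longrightarrow> a *\<^sub>C z \<in> M"
  shows "orthogonal_projection M x \<in> M"
    and "\<And>z. z \<in> M \<Longrightarrow> cinner (x - orthogonal_projection M x) z = 0"
proof -
  obtain y where y: "y \<in> M" "\<And>z. z \<in> M \<Longrightarrow> cinner (x - y) z = 0"
    using orthogonal_decomposition[OF assms] by blast
  have "orthogonal_projection M x = y"
    unfolding orthogonal_projection_def
  proof (rule the_equality)
    fix y' assume y': "y' \<in> M \<and> (\<forall>z\<in>M. cinner (x - y') z = 0)"
    \<comment> \<open>The difference of two candidates lies in \<open>M\<close> and is orthogonal to
      \<open>M\<close>, hence to itself.\<close>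
    then have "y' - y \<in> M" using y assms(2) by (simp add: subspace_diff)
    then have "cinner ((x - y) - (x - y')) (y' - y) = 0"
      using y y' by (simp only: cinner_diff_left[of "x - y"]) simp
    then show "y' = y" by (simp add: cinner_self_eq_0_iff)
  qed (use y in simp)
  with y show "orthogonal_projection M x \<in> M"
    "\<And>z. z \<in> M \<Longrightarrow> cinner (x - orthogonal_projection M x) z = 0" by auto
qed


section \<open>Positive operators\<close>

text \<open>On a complex space a real quadratic form forces symmetry: expanding it at
  \<open>u + v\<close> relates the imaginary parts of the cross terms, and replacing
  \<open>y\<close> by \<open>\<i> *\<^sub>C y\<close> turns this into a relation of real
  parts.\<close>

lemma positive_operator_selfadjoint:
  assumes "positive_operator A"
  shows "cinner (A x) y = cinner x (A y)"
proof -
  have lin: "linear A" and scale: "\<And>a x. A (a *\<^sub>C x) = a *\<^sub>C A x"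
    using assms by (auto simp: positive_operator_def bounded_operator_def bounded_linear.linear)
  have real: "Im (cinner (A z) z) = 0" for z
    using assms by (auto simp: positive_operator_def complex_is_Real_iff)
  then have cross: "Im (cinner (A u) v) + Im (cinner (A v) u) = 0" for u v
    using real[of "u + v"] real[of u] real[of v]
    by (simp add: linear_add[OF lin] cinner_add_left cinner_add_right)
  have "Im (cinner (A x) y) = - Im (cinner (A y) x)"
    using cross[of x y] by simp
  moreover have "Re (cinner (A x) y) = Re (cinner (A y) x)"
    using cross[of x "\<i> *\<^sub>C y"] by (simp add: scale cinner_scaleC_left cinner_scaleC_right)
  ultimately have "cinner (A x) y = cnj (cinner (A y) x)" by (simp add: complex_eq_iff)
  then show ?thesis using cinner_commute[of x "A y"] by simp
qed

text \<open>By self-adjointness, \<open>A x = A y\<close> makes \<open>x - y\<close> orthogonal to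
  the range, hence to its closure, which contains both points.\<close>

lemma positive_operator_inj_on_closure_range:
  assumes "positive_operator A"
  shows "inj_on A (closure (range A))"
proof (rule inj_onI)
  fix x y assume xy: "x \<in> closure (range A)" "y \<in> closure (range A)" "A x = A y"
  have "cinner u x = cinner u y" if "u \<in> range A" for u
    using that xy(3) by (auto simp: positive_operator_selfadjoint[OF assms])
  then have "cinner u x = cinner u y" if "u \<in> closure (range A)" for u
    using that by (rule cinner_left_eq_on_closure)
  then have "cinner (x - y) (x - y) = 0"
    using xy(1,2) by (simp add: cinner_diff_left cinner_diff_right)
  then show "x = y" by (simp add: cinner_self_eq_0_iff)
qed

text \<open>The remainder \<open>x - range_projection A x\<close> is orthogonal to the range of the
  self-adjoint \<open>A\<close>, so \<open>A\<close> kills it.\<close>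

lemma range_projection_properties:
  assumes "positive_operator A"
  shows range_projection_in: "range_projection A x \<in> closure (range A)"
    and apply_range_projection: "A (range_projection A x) = A x"
proof -
  have lin: "linear A" and scale: "\<And>a x. A (a *\<^sub>C x) = a *\<^sub>C A x"
    using assms by (auto simp: positive_operator_def bounded_operator_def bounded_linear.linear)
  let ?M = "closure (range A)"
  have "subspace ?M"
    by (intro subspace_closure linear_subspace_image lin subspace_UNIV)
  moreover have "a *\<^sub>C z \<in> ?M" if "z \<in> ?M" for a z
  proof -
    \<comment> \<open>\<open>subspace\<close> covers only real scalars; invariance under complex
      ones passes from the range to its closure by continuity.\<close>
    have "(*\<^sub>C) a ` range A \<subseteq> range A" by (auto simp flip: scale)
    then have "(*\<^sub>C) a ` ?M \<subseteq> ?M"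
      by (intro image_closure_subset linear_continuous_on bounded_linear_scaleC closed_closure)
        (meson closure_subset order_trans)
    then show ?thesis using that by blast
  qed
  ultimately have proj: "orthogonal_projection ?M x \<in> ?M"
    "\<And>z. z \<in> ?M \<Longrightarrow> cinner (x - orthogonal_projection ?M x) z = 0"
    by (auto intro!: orthogonal_projection_properties)
  then show "range_projection A x \<in> ?M" by (simp add: range_projection_def)
  have "cinner (A (x - range_projection A x)) (A (x - range_projection A x)) = 0"
    unfolding positive_operator_selfadjoint[OF assms] range_projection_def
    by (intro proj(2) subsetD[OF closure_subset] rangeI)
  then show "A (range_projection A x) = A x"
    by (simp add: cinner_self_eq_0_iff linear_diff[OF lin])
qed


section \<open>Adjoints\<close>

text \<open>Density of the domain makes the vector chosen by \<open>THE\<close> unique, so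
  membership in the graph of the adjoint becomes an identity of inner products.\<close>

lemma hilbert_adjoint_eq_Some_iff:
  assumes "densely_defined T"
  shows "hilbert_adjoint T y = Some z \<longleftrightarrow> (\<forall>x u. T x = Some u \<longrightarrow> cinner u y = cinner x z)"
    (is "_ \<longleftrightarrow> ?adj z")
proof -
  have unique: "z = z'" if "?adj z" "?adj z'" for z z'
  proof -
    have "cinner x z = cinner x z'" if x: "x \<in> dom T" for x
    proof -
      obtain u where u: "T x = Some u" using x by blast
      have "cinner u y = cinner x z" "cinner u y = cinner x z'"
        using u \<open>?adj z\<close> \<open>?adj z'\<close> by blast+
      then show ?thesis by simp
    qed
    then have "cinner x z = cinner x z'" for x
      by (rule cinner_left_eq_on_closure[of "dom T"])
        (use assms in \<open>simp_all add: densely_defined_def\<close>)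
    then have "cinner (z - z') (z - z') = 0" by (simp add: cinner_diff_right)
    then show ?thesis by (simp add: cinner_self_eq_0_iff)
  qed
  show ?thesis
  proof
    assume "?adj z"
    then have "(THE z. ?adj z) = z" using unique by (intro the_equality)
    with \<open>?adj z\<close> show "hilbert_adjoint T y = Some z"
      unfolding hilbert_adjoint_def by auto
  next
    assume y: "hilbert_adjoint T y = Some z"
    then have ex: "\<exists>z. ?adj z" and z: "z = (THE z. ?adj z)"
      unfolding hilbert_adjoint_def by (auto split: if_splits)
    from ex unique have "\<exists>!z. ?adj z" by blast
    then have "?adj (THE z. ?adj z)" by (rule theI')
    then show "?adj z" unfolding z .
  qed
qed

text \<open>This replaces the operator equation by a test on graphs, to which all four inclusions
  reduce. Assumed existence supplies the domain: the adjoint is defined at \<open>y\<close> exactly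
  when \<open>hilbert_adjoint T\<close> is defined at \<open>B y\<close>.\<close>

lemma reduced_adjoint_eq_Some_iff:
  assumes A: "positive_operator A" and T: "has_reduced_adjoint A B T"
  shows "reduced_adjoint A B T y = Some z \<longleftrightarrow>
    z \<in> closure (range A) \<and> (\<forall>x u. T x = Some u \<longrightarrow> cinner u (B y) = cinner x (A z))"
proof -
  have dense: "densely_defined T" using T by (simp add: has_reduced_adjoint_def)
  have iff: "X y = Some z \<longleftrightarrow>
      z \<in> closure (range A) \<and> (\<forall>x u. T x = Some u \<longrightarrow> cinner u (B y) = cinner x (A z))"
    if X: "is_reduced_adjoint A B T X" for X y z
  proof -
    have eq: "map_option A (X y) = hilbert_adjoint T (B y)" for y
    proof -
      have "(total_op A \<circ>\<^sub>m X) y = (hilbert_adjoint T \<circ>\<^sub>m total_op B) y"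
        using X by (simp add: is_reduced_adjoint_def)
      then show ?thesis by (cases "X y") auto
    qed
    have in_range: "z \<in> closure (range A)" if "X y = Some z" for y z
      using X that by (auto simp: is_reduced_adjoint_def ran_def)
    \<comment> \<open>From right to left, the value of \<open>X\<close> at \<open>y\<close> and
      \<open>z\<close> have the same image under \<open>A\<close> and both lie in the closure of its
      range, where \<open>A\<close> is injective.\<close>
    have "X y = Some z \<longleftrightarrow> z \<in> closure (range A) \<and> map_option A (X y) = Some (A z)"
      using in_range inj_onD[OF positive_operator_inj_on_closure_range[OF A]]
      by (cases "X y") auto
    then show ?thesis
      by (simp only: eq hilbert_adjoint_eq_Some_iff[OF dense])
  qed
  obtain X where X: "is_reduced_adjoint A B T X"
    using T by (auto simp: has_reduced_adjoint_def)
  have "Y = X" if Y: "is_reduced_adjoint A B T Y" for Y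
  proof
    fix y
    have "Y y = Some z \<longleftrightarrow> X y = Some z" for z by (simp only: iff[OF X] iff[OF Y])
    then show "Y y = X y" by (metis not_Some_eq)
  qed
  then have "reduced_adjoint A B T = X"
    unfolding reduced_adjoint_def using X by (intro the_equality)
  then show ?thesis by (simp only: iff[OF X])
qed


section \<open>Analysis and synthesis\<close>

text \<open>Continuity of the inner product in its first argument allows the series for
  \<open>u\<close> to be paired with \<open>f\<close> term by term.\<close>

lemma cinner_synthesis_analysis:
  assumes "synthesis_op F c = Some u" "analysis_op F f = Some d"
  shows "cinner u f = cinner c d"
proof -
  have "(\<lambda>n. coord c n *\<^sub>C F n) sums u"
    using assms(1) by (auto simp: synthesis_op_def summable_sums split: if_splits)
  then have "(\<lambda>n. cinner (coord c n *\<^sub>C F n) f) sums cinner u f"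
    unfolding sums_def cinner_sum_left[symmetric] by (rule tendsto_cinner_left)
  moreover have "coord d n = cinner f (F n)" for n
    using assms(2) by (auto simp: analysis_op_def Abs_ell2_inverse split: if_splits)
  then have "cinner (coord c n *\<^sub>C F n) f = coord c n * cnj (coord d n)" for n
    using cinner_commute[of "F n" f] by (simp add: cinner_scaleC_left)
  ultimately show ?thesis by (simp add: cinner_ell2_def sums_iff)
qed

lemma cinner_D_AB_C_AB:
  assumes "positive_operator B" "D_AB B F c = Some u" "C_AB A F f = Some d"
  shows "cinner u (A f) = cinner c (B d)"
  using cinner_synthesis_analysis[of F "B c" u "A f" d] assms
  by (simp add: D_AB_def C_AB_def positive_operator_selfadjoint)

theorem proposition4p11:
  fixes A :: "'a::chilbert_space \<Rightarrow> 'a"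
    and B :: "ell2 \<Rightarrow> ell2"
    and F :: "nat \<Rightarrow> 'a"
  assumes "positive_operator A"
    and "positive_operator B"
    and "densely_defined (C_AB A F)"
    and "densely_defined (D_AB B F)"
    and "densely_defined (S_AB A B F)"
    and "has_reduced_adjoint A B (C_AB A F)"
    and "has_reduced_adjoint B A (D_AB B F)"
    and "has_A_adjoint A (S_AB A B F)"
  shows "(total_op (range_projection B) \<circ>\<^sub>m C_AB A F \<subseteq>\<^sub>m reduced_adjoint B A (D_AB B F))
    \<and> (total_op (range_projection A) \<circ>\<^sub>m D_AB B F \<circ>\<^sub>m total_op (range_projection B)
          \<subseteq>\<^sub>m reduced_adjoint A B (C_AB A F))
    \<and> (reduced_adjoint A B (C_AB A F) \<circ>\<^sub>m reduced_adjoint B A (D_AB B F)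
          \<subseteq>\<^sub>m A_adjoint A (S_AB A B F))
    \<and> (total_op (range_projection A) \<circ>\<^sub>m S_AB A B F \<subseteq>\<^sub>m A_adjoint A (S_AB A B F))"
proof -
  note A = assms(1) and B = assms(2)
  note C_adj = reduced_adjoint_eq_Some_iff[OF A assms(6)]
  note D_adj = reduced_adjoint_eq_Some_iff[OF B assms(7)]
  have "has_reduced_adjoint A A (S_AB A B F)"
    using assms(8) by (simp add: has_A_adjoint_def)
  note S_adj = reduced_adjoint_eq_Some_iff[OF A this, folded A_adjoint_def]
  have D_Some: "reduced_adjoint B A (D_AB B F) f = Some (range_projection B d)"
    if "C_AB A F f = Some d" for f d
    unfolding D_adj apply_range_projection[OF B]
    using range_projection_in[OF B] cinner_D_AB_C_AB[OF B _ that] by blast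
  have D_proj: "D_AB B F (range_projection B c) = D_AB B F c" for c
    by (simp add: D_AB_def apply_range_projection[OF B])
  have C_Some: "reduced_adjoint A B (C_AB A F) c = Some (range_projection A u)"
    if c: "D_AB B F c = Some u" for c u
  proof -
    have "cinner d (B c) = cinner f (A u)" if f: "C_AB A F f = Some d" for f d
    proof -
      \<comment> \<open>The duality has the synthesis side on the left, so it is applied between two
        conjugations.\<close>
      have "cinner d (B c) = cnj (cinner c (B d))"
        using cinner_commute[of d "B c"] by (simp add: positive_operator_selfadjoint[OF B])
      also have "\<dots> = cnj (cinner u (A f))"
        by (simp add: cinner_D_AB_C_AB[OF B c f])
      also have "\<dots> = cinner f (A u)"
        using cinner_commute[of f "A u"] by (simp add: positive_operator_selfadjoint[OF A])
      finally show ?thesis .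
    qed
    then show ?thesis
      unfolding C_adj apply_range_projection[OF A] using range_projection_in[OF A] by blast
  qed
  have S_Some: "A_adjoint A (S_AB A B F) f = Some g"
    if d: "reduced_adjoint B A (D_AB B F) f = Some d"
      and g: "reduced_adjoint A B (C_AB A F) d = Some g" for f d g
  proof -
    have "cinner u (A f) = cinner x (A g)" if "S_AB A B F x = Some u" for x u
    proof -
      \<comment> \<open>Passing through \<open>c\<close>, the condition on \<open>d\<close> gives
        \<open>cinner u (A f) = cinner c (B d)\<close>, and the one on \<open>g\<close> gives
        \<open>cinner c (B d) = cinner x (A g)\<close>.\<close>
      obtain c where "C_AB A F x = Some c" "D_AB B F c = Some u"
        using \<open>S_AB A B F x = Some u\<close> by (auto simp: S_AB_def map_comp_Some_iff)
      then show ?thesis using d g by (metis C_adj D_adj)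
    qed
    then show ?thesis using g unfolding S_adj C_adj by blast
  qed
  show ?thesis
  proof (intro conjI)
    show "total_op (range_projection B) \<circ>\<^sub>m C_AB A F \<subseteq>\<^sub>m reduced_adjoint B A (D_AB B F)"
      by (auto simp: map_le_def map_comp_Some_iff D_Some)
    show "total_op (range_projection A) \<circ>\<^sub>m D_AB B F \<circ>\<^sub>m total_op (range_projection B)
        \<subseteq>\<^sub>m reduced_adjoint A B (C_AB A F)"
      by (auto simp: map_le_def map_comp_Some_iff D_proj C_Some)
    show "reduced_adjoint A B (C_AB A F) \<circ>\<^sub>m reduced_adjoint B A (D_AB B F)
        \<subseteq>\<^sub>m A_adjoint A (S_AB A B F)"
      by (auto simp: map_le_def map_comp_Some_iff S_Some)
    \<comment> \<open>The intermediate vector is \<open>range_projection B d\<close>; by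
      \<open>D_proj\<close> it has the same image \<open>u\<close> under \<open>D_AB B F\<close> as
      \<open>d\<close>, so (1) and (2) chain into (3).\<close>
    have "A_adjoint A (S_AB A B F) f = Some (range_projection A u)"
      if "C_AB A F f = Some d" "D_AB B F d = Some u" for f d u
      using that by (intro S_Some[OF D_Some C_Some]) (simp_all add: D_proj)
    then show "total_op (range_projection A) \<circ>\<^sub>m S_AB A B F \<subseteq>\<^sub>m A_adjoint A (S_AB A B F)"
      by (auto simp: map_le_def S_AB_def map_comp_Some_iff)
  qed
qed

end
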